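(* Let $k$ be an algebraically closed field, $R$ a finitely generated commutative $k$-algebra, $M$ a Noetherian $R$-module, $y=(y_1,\ldots,y_m)$ an $m$-tuple in $R$ and $y'=(y_1,\ldots,y_{m-1})$. Then $\sigma(y',M)=\pi(\sigma(y,M))$, where $\pi:k^m\to k^{m-1}$ is the projection onto the first $m-1$ coordinates.
   Context: For a commutative $k$-algebra $R$, an $R$-module $M$ and an $n$-tuple $y$ in $R$, the Koszul complex $\operatorname{Kos}(y,M)$ is $0\leftarrow M\leftarrow M\otimes_k\wedge^1k^n\leftarrow\cdots\leftarrow M\otimes_k\wedge^nk^n\leftarrow 0$ with differential $\partial(u\otimes e_{i_1}\wedge\cdots\wedge e_{i_p})=\sum_{s=1}^p(-1)^{s+1}y_{i_s}u\otimes e_{i_1}\wedge\cdots\wedge\widehat{e_{i_s}}\wedge\cdots\wedge e_{i_p}$. For $a\in k^n$, $y-a=(y_1-a_1,\ldots,y_n-a_n)$. The Taylor spectrum $\sigma(y,M)$ is the set of $a\in k^n$ such that $\operatorname{Kos}(y-a,M)$ is not exact. *)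

theory Defs
  imports "HOL-Computational_Algebra.Polynomial"
begin

definition alg_closed :: "'k::field itself \<Rightarrow> bool" where
  "alg_closed _ \<longleftrightarrow> (\<forall>p :: 'k poly. degree p \<ge> 1 \<longrightarrow> (\<exists>x. poly p x = 0))"

(* structure map of a commutative k-algebra R *)
definition is_ring_hom :: "('k::field \<Rightarrow> 'r::comm_ring_1) \<Rightarrow> bool" where
  "is_ring_hom \<phi> \<longleftrightarrow> \<phi> 1 = 1 \<and> (\<forall>a b. \<phi> (a + b) = \<phi> a + \<phi> b) \<and> (\<forall>a b. \<phi> (a * b) = \<phi> a * \<phi> b)"

inductive_set alg_generated :: "('k \<Rightarrow> 'r::comm_ring_1) \<Rightarrow> 'r set \<Rightarrow> 'r set"
  for \<phi> :: "'k \<Rightarrow> 'r" and S :: "'r set" where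
  gen: "x \<in> S \<Longrightarrow> x \<in> alg_generated \<phi> S"
| scalar: "\<phi> c \<in> alg_generated \<phi> S"
| add: "x \<in> alg_generated \<phi> S \<Longrightarrow> z \<in> alg_generated \<phi> S \<Longrightarrow> x + z \<in> alg_generated \<phi> S"
| mult: "x \<in> alg_generated \<phi> S \<Longrightarrow> z \<in> alg_generated \<phi> S \<Longrightarrow> x * z \<in> alg_generated \<phi> S"

definition finitely_generated_algebra :: "('k \<Rightarrow> 'r::comm_ring_1) \<Rightarrow> bool" where
  "finitely_generated_algebra \<phi> \<longleftrightarrow> (\<exists>S. finite S \<and> alg_generated \<phi> S = UNIV)"

definition noetherian_module :: "('r::comm_ring_1 \<Rightarrow> 'm::ab_group_add \<Rightarrow> 'm) \<Rightarrow> bool" where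
  "noetherian_module scale \<longleftrightarrow> module scale \<and>
     (\<forall>N. module.subspace scale N \<longrightarrow> (\<exists>F. finite F \<and> F \<subseteq> N \<and> module.span scale F = N))"

(* Koszul complex Kos(y,M), n = length y.  M \<otimes>_k \<wedge>^p k^n is identified with
   the functions assigning to each p-subset I of {0..<n} the coefficient of e_I. *)
definition koszul_chains :: "nat \<Rightarrow> nat \<Rightarrow> (nat set \<Rightarrow> 'm::zero) set" where
  "koszul_chains n p = {c. \<forall>I. c I \<noteq> 0 \<longrightarrow> I \<subseteq> {..<n} \<and> card I = p}"

(* \<partial>(u \<otimes> e_{i_1}\<and>...\<and>e_{i_p}) = \<Sum>_s (-1)^(s+1) y_{i_s} u \<otimes> e_{I - i_s}, i_1<...<i_p;
   (-1)^(s+1) = (-1)^(number of elements of I smaller than i_s) *)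
definition koszul_diff :: "('r::comm_ring_1 \<Rightarrow> 'm::ab_group_add \<Rightarrow> 'm) \<Rightarrow> 'r list \<Rightarrow>
    (nat set \<Rightarrow> 'm) \<Rightarrow> (nat set \<Rightarrow> 'm)" where
  "koszul_diff scale y c = (\<lambda>J. if J \<subseteq> {..<length y} then
      (\<Sum>i\<in>{..<length y} - J. scale ((-1) ^ card {j\<in>J. j < i} * y ! i) (c (insert i J)))
    else 0)"

definition koszul_exact :: "('r::comm_ring_1 \<Rightarrow> 'm::ab_group_add \<Rightarrow> 'm) \<Rightarrow> 'r list \<Rightarrow> bool" where
  "koszul_exact scale y \<longleftrightarrow> (\<forall>p \<le> length y.
     {c \<in> koszul_chains (length y) p. koszul_diff scale y c = (\<lambda>_. 0)}
       = koszul_diff scale y ` koszul_chains (length y) (Suc p))"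

definition taylor_spectrum :: "('k \<Rightarrow> 'r::comm_ring_1) \<Rightarrow> ('r \<Rightarrow> 'm::ab_group_add \<Rightarrow> 'm) \<Rightarrow>
    'r list \<Rightarrow> 'k list set" where
  "taylor_spectrum \<phi> scale y = {a. length a = length y \<and>
     \<not> koszul_exact scale (map2 (\<lambda>yi ai. yi - \<phi> ai) y a)}"

end

theory Submission
  imports Defs
begin

text \<open>
  \<open>Kos(y @ [t])\<close> is the mapping cone of multiplication by \<open>t\<close> on \<open>Kos(y)\<close>. Hence it is exact if
  \<open>Kos(y)\<close> is, and its exactness forces \<open>t\<close> to act surjectively on the homology of \<open>Kos(y)\<close>.
  It remains to find, for a nonzero homology module \<open>Z / B\<close>, a scalar \<open>c\<close> such that \<open>t - c\<close> is not
  surjective on it. Projecting to coordinates reduces this to submodules \<open>B \<subset> Z\<close> of the Noetherian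
  module itself. A maximal submodule \<open>N\<close> with \<open>B \<subseteq> N \<subset> Z\<close> gives a simple quotient \<open>Z / N\<close>, whose
  annihilator \<open>M\<close> is a maximal ideal; by the weak Nullstellensatz \<open>t - c \<in> M\<close> for some \<open>c\<close>.

  The Nullstellensatz is proved by Goldman's method. If the field \<open>R / M\<close> is generated as a ring by a
  subring \<open>A\<close> and finitely many elements, then inverting a single element makes \<open>A\<close> a field. If
  \<open>A = k[t]\<close>, then this fails for transcendental \<open>t\<close>, so \<open>t\<close> is algebraic over \<open>k\<close>.
  Instead of passing to the quotient, one computes modulo \<open>M\<close> with subrings containing \<open>M\<close>.
\<close>

section \<open>The weak Nullstellensatz\<close>

text \<open>\<open>inverse_mod\<close> says that the residue ring is a field; maximality enters the
  computations in this form.\<close>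

locale maximal_ideal =
  fixes M :: "'r::comm_ring_1 set"
  assumes zero_mem: "0 \<in> M"
    and add_mem: "a \<in> M \<Longrightarrow> b \<in> M \<Longrightarrow> a + b \<in> M"
    and mult_mem: "a \<in> M \<Longrightarrow> r * a \<in> M"
    and one_not_mem: "1 \<notin> M"
    and inverse_mod: "r \<notin> M \<Longrightarrow> \<exists>s. 1 - s * r \<in> M"
begin

definition cong_mod :: "'r \<Rightarrow> 'r \<Rightarrow> bool" (infix "\<approx>" 50) where
  "a \<approx> b \<longleftrightarrow> a - b \<in> M"

text \<open>Containing \<open>M\<close> makes these sets exactly the preimages of the subrings of
  the residue field.\<close>

definition subring_over :: "'r set \<Rightarrow> bool" where
  "subring_over A \<longleftrightarrow> M \<subseteq> A \<and> 1 \<in> A \<and> (\<forall>a\<in>A. - a \<in> A) \<and>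
     (\<forall>a\<in>A. \<forall>b\<in>A. a + b \<in> A) \<and> (\<forall>a\<in>A. \<forall>b\<in>A. a * b \<in> A)"

definition poly_over :: "'r set \<Rightarrow> 'r poly \<Rightarrow> bool" where
  "poly_over A p \<longleftrightarrow> (\<forall>i. coeff p i \<in> A)"

definition adjoin :: "'r set \<Rightarrow> 'r \<Rightarrow> 'r set" where
  "adjoin A x = {poly p x |p. poly_over A p}"

text \<open>The relation stays nonzero modulo \<open>M\<close>. Its degree is automatically
  positive, because a constant outside \<open>M\<close> has no value in \<open>M\<close>.\<close>

definition algebraic_mod :: "'r set \<Rightarrow> 'r \<Rightarrow> bool" where
  "algebraic_mod A x \<longleftrightarrow> (\<exists>p. poly_over A p \<and> poly p x \<in> M \<and> lead_coeff p \<notin> M)"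

text \<open>Modulo \<open>M\<close>, the localisation of \<open>A\<close> at one nonzero element is a field.\<close>

definition goldman :: "'r set \<Rightarrow> bool" where
  "goldman A \<longleftrightarrow> (\<exists>a\<in>A - M. \<forall>b\<in>A - M. \<exists>N. \<exists>c\<in>A. a ^ N \<approx> b * c)"

section \<open>Arithmetic modulo the maximal ideal\<close>

lemma mult_mem': "a \<in> M \<Longrightarrow> a * r \<in> M"
  using mult_mem[of a r] by (simp add: mult.commute)

lemma uminus_mem: "a \<in> M \<Longrightarrow> - a \<in> M"
  using mult_mem[of a "-1"] by simp

lemma diff_mem: "a \<in> M \<Longrightarrow> b \<in> M \<Longrightarrow> a - b \<in> M"
  using add_mem[of a "- b"] uminus_mem[of b] by simp

lemma sum_mem: "(\<And>i. i \<in> I \<Longrightarrow> f i \<in> M) \<Longrightarrow> sum f I \<in> M"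
  by (induction I rule: infinite_finite_induct) (auto intro: zero_mem add_mem)

lemma prime_mem:
  assumes "r * s \<in> M" shows "r \<in> M \<or> s \<in> M"
proof (rule disjCI)
  assume "s \<notin> M"
  then obtain u where "1 - u * s \<in> M"
    using inverse_mod by blast
  then have "r * (1 - u * s) + u * (r * s) \<in> M"
    using add_mem[OF mult_mem mult_mem[OF assms]] by blast
  then show "r \<in> M"
    by (simp add: algebra_simps)
qed

lemma power_not_mem: "r \<notin> M \<Longrightarrow> r ^ n \<notin> M"
  by (induction n) (auto simp: one_not_mem dest: prime_mem)

lemma cong_refl [simp]: "a \<approx> a"
  by (simp add: cong_mod_def zero_mem)

lemma cong_sym: "a \<approx> b \<Longrightarrow> b \<approx> a"
  unfolding cong_mod_def using uminus_mem[of "a - b"] by simp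

lemma cong_trans [trans]: "a \<approx> b \<Longrightarrow> b \<approx> c \<Longrightarrow> a \<approx> c"
  unfolding cong_mod_def using add_mem[of "a - b" "b - c"] by simp

lemma cong_add: "a \<approx> b \<Longrightarrow> c \<approx> d \<Longrightarrow> a + c \<approx> b + d"
  unfolding cong_mod_def using add_mem[of "a - b" "c - d"] by (simp add: algebra_simps)

lemma cong_mult:
  assumes "a \<approx> b" "c \<approx> d" shows "a * c \<approx> b * d"
proof -
  have "c * (a - b) + b * (c - d) \<in> M"
    using assms unfolding cong_mod_def by (intro add_mem mult_mem)
  then show ?thesis
    by (simp add: cong_mod_def algebra_simps)
qed

lemma cong_power: "a \<approx> b \<Longrightarrow> a ^ n \<approx> b ^ n"
  by (induction n) (auto intro: cong_mult)

lemma cong_mem_iff: "a \<approx> b \<Longrightarrow> a \<in> M \<longleftrightarrow> b \<in> M"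
  unfolding cong_mod_def
  using add_mem[of "a - b" b] diff_mem[of a "a - b"] by auto

lemma poly_mem: "(\<And>i. coeff p i \<in> M) \<Longrightarrow> poly p x \<in> M"
  unfolding poly_altdef by (intro sum_mem mult_mem')

lemma poly_cong: "(\<And>i. coeff p i \<approx> coeff q i) \<Longrightarrow> poly p x \<approx> poly q x"
  using poly_mem[of "p - q" x] by (simp add: cong_mod_def)

section \<open>Polynomials over subrings that contain the ideal\<close>

context
  fixes A
  assumes A: "subring_over A"
begin

lemma sub_add: "a \<in> A \<Longrightarrow> b \<in> A \<Longrightarrow> a + b \<in> A"
  and sub_mult: "a \<in> A \<Longrightarrow> b \<in> A \<Longrightarrow> a * b \<in> A"
  and sub_uminus: "a \<in> A \<Longrightarrow> - a \<in> A"
  and sub_one: "1 \<in> A"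
  and sub_ideal: "a \<in> M \<Longrightarrow> a \<in> A"
  using A by (auto simp: subring_over_def)

lemma sub_zero: "0 \<in> A"
  by (rule sub_ideal[OF zero_mem])

lemma sub_power: "a \<in> A \<Longrightarrow> a ^ n \<in> A"
  by (induction n) (auto intro: sub_one sub_mult)

lemma sub_sum: "(\<And>i. i \<in> I \<Longrightarrow> f i \<in> A) \<Longrightarrow> sum f I \<in> A"
  by (induction I rule: infinite_finite_induct) (auto intro: sub_zero sub_add)

lemma poly_over_add: "poly_over A p \<Longrightarrow> poly_over A q \<Longrightarrow> poly_over A (p + q)"
  by (simp add: poly_over_def sub_add)

lemma poly_over_uminus: "poly_over A p \<Longrightarrow> poly_over A (- p)"
  by (simp add: poly_over_def sub_uminus)

lemma poly_over_diff: "poly_over A p \<Longrightarrow> poly_over A q \<Longrightarrow> poly_over A (p - q)"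
  using poly_over_add[of p "- q"] poly_over_uminus[of q] by simp

lemma poly_over_mult: "poly_over A p \<Longrightarrow> poly_over A q \<Longrightarrow> poly_over A (p * q)"
  unfolding poly_over_def coeff_mult by (auto intro!: sub_sum sub_mult)

lemma poly_over_smult: "a \<in> A \<Longrightarrow> poly_over A p \<Longrightarrow> poly_over A (smult a p)"
  by (simp add: poly_over_def sub_mult)

lemma poly_over_monom: "a \<in> A \<Longrightarrow> poly_over A (monom a n)"
  by (simp add: poly_over_def sub_zero)

lemma poly_over_pCons: "a \<in> A \<Longrightarrow> poly_over A p \<Longrightarrow> poly_over A (pCons a p)"
  by (auto simp: poly_over_def coeff_pCons split: nat.split)

lemma poly_over_0: "poly_over A 0"
  by (simp add: poly_over_def sub_zero)

lemma adjoin_incl: "A \<subseteq> adjoin A x"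
proof
  fix a assume "a \<in> A"
  then show "a \<in> adjoin A x"
    unfolding adjoin_def by (auto intro!: exI[of _ "[:a:]"] poly_over_pCons poly_over_0)
qed

lemma adjoin_self: "x \<in> adjoin A x"
  unfolding adjoin_def
  by (auto intro!: exI[of _ "[:0, 1:]"] poly_over_pCons poly_over_0 sub_zero sub_one)

lemma subring_adjoin: "subring_over (adjoin A x)"
proof -
  have "M \<subseteq> adjoin A x" "1 \<in> adjoin A x"
    using adjoin_incl sub_ideal sub_one by blast+
  moreover have "- poly p x \<in> adjoin A x" if "poly_over A p" for p
    unfolding adjoin_def using poly_over_uminus[OF that] by (auto intro!: exI[of _ "- p"])
  moreover have "poly p x + poly q x \<in> adjoin A x" if "poly_over A p" "poly_over A q" for p q
    unfolding adjoin_def using poly_over_add[OF that] by (auto intro!: exI[of _ "p + q"])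
  moreover have "poly p x * poly q x \<in> adjoin A x" if "poly_over A p" "poly_over A q" for p q
    unfolding adjoin_def using poly_over_mult[OF that] by (auto intro!: exI[of _ "p * q"])
  ultimately show ?thesis
    unfolding subring_over_def by (auto simp: adjoin_def)
qed

text \<open>Discarding the coefficients in \<open>M\<close> makes the formal degree agree with the
  degree modulo \<open>M\<close>; the coefficient outside \<open>M\<close> ensures that something
  remains.\<close>

lemma poly_over_truncate:
  assumes p: "poly_over A p" and i: "coeff p i \<notin> M"
  obtains q where "poly_over A q" "\<And>j. coeff q j \<approx> coeff p j" "lead_coeff q \<notin> M"
    "degree q \<le> degree p"
proof
  define q where "q = map_poly (\<lambda>c. if c \<in> M then 0 else c) p"
  have coeff_q: "coeff q j = (if coeff p j \<in> M then 0 else coeff p j)" for j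
    by (simp add: q_def coeff_map_poly zero_mem)
  show "poly_over A q"
    using p by (auto simp: poly_over_def coeff_q sub_zero)
  show "coeff q j \<approx> coeff p j" for j
    by (simp add: coeff_q cong_mod_def uminus_mem zero_mem)
  have "coeff p i \<noteq> 0"
    using i zero_mem by auto
  then have "q \<noteq> 0"
    using i coeff_q[of i] by auto
  then have "lead_coeff q \<noteq> 0"
    by simp
  then show "lead_coeff q \<notin> M"
    unfolding coeff_q by (metis (full_types))
  show "degree q \<le> degree p"
    by (rule degree_le) (simp add: coeff_q coeff_eq_0)
qed

text \<open>Each step multiplies by the leading coefficient of \<open>H\<close>, which need not be
  invertible, and cancels the top term. The bound on \<open>degree Q\<close> later puts a quotient
  below the degree of a minimal relation.\<close>

lemma pseudo_division_over:
  assumes H: "poly_over A H" "H \<noteq> 0" and P: "poly_over A P"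
  shows "\<exists>s Q R. poly_over A Q \<and> poly_over A R \<and> smult (lead_coeff H ^ s) P = Q * H + R \<and>
    (R = 0 \<or> degree R < degree H) \<and> degree Q \<le> degree P - degree H"
  using P
\<comment> \<open>The shift by \<open>Suc\<close> makes the zero polynomial smaller than the nonzero
  constants, which have the same degree.\<close>
proof (induction "if P = 0 then 0 else Suc (degree P)" arbitrary: P rule: less_induct)
  case less
  show ?case
  proof (cases "P = 0 \<or> degree P < degree H")
    case True
    then show ?thesis
      using less.prems by (intro exI[of _ 0] exI[of _ 0] exI[of _ P]) (auto simp: poly_over_0)
  next
    case False
    define T where "T = monom (lead_coeff P) (degree P - degree H)"
    define P' where "P' = smult (lead_coeff H) P - T * H"
    have lcs: "lead_coeff H \<in> A" "lead_coeff P \<in> A"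
      using H less.prems by (auto simp: poly_over_def)
    have T: "poly_over A T"
      unfolding T_def by (intro poly_over_monom lcs)
    have P': "poly_over A P'"
      unfolding P'_def by (intro poly_over_diff poly_over_smult poly_over_mult T lcs H less.prems)
    have degT: "degree T \<le> degree P - degree H"
      unfolding T_def by (rule degree_monom_le)
    have "degree (T * H) \<le> degree P"
      using degree_mult_le[of T H] degT False by linarith
    then have deg: "degree P' \<le> degree P"
      unfolding P'_def by (intro degree_diff_le degree_smult_le)
    have "coeff P' (degree P) = 0"
      using False coeff_monom_mult[of "lead_coeff P" "degree P - degree H" H "degree P"]
      by (simp add: P'_def T_def mult.commute)
    then have "P' = 0 \<or> degree P' < degree P"
      using deg by (metis le_neq_implies_less leading_coeff_0_iff)
    then have "(if P' = 0 then 0 else Suc (degree P')) < (if P = 0 then 0 else Suc (degree P))"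
      using False by auto
    then obtain s Q R where QR: "poly_over A Q" "poly_over A R"
      "smult (lead_coeff H ^ s) P' = Q * H + R" "R = 0 \<or> degree R < degree H"
      "degree Q \<le> degree P' - degree H"
      using less.hyps[OF _ P'] by blast
    show ?thesis
    proof (intro exI conjI)
      show "poly_over A (Q + smult (lead_coeff H ^ s) T)"
        by (intro poly_over_add poly_over_smult sub_power QR T lcs)
      show "smult (lead_coeff H ^ Suc s) P = (Q + smult (lead_coeff H ^ s) T) * H + R"
        using QR(3) by (simp add: P'_def algebra_simps smult_diff_right)
      show "degree (Q + smult (lead_coeff H ^ s) T) \<le> degree P - degree H"
      proof (rule degree_add_le)
        show "degree Q \<le> degree P - degree H"
          using QR(5) deg by linarith
        show "degree (smult (lead_coeff H ^ s) T) \<le> degree P - degree H"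
          using degree_smult_le degT by (rule order_trans)
      qed
    qed (use QR in auto)
  qed
qed

lemma not_algebraic_coeffs:
  assumes "\<not> algebraic_mod A x" "poly_over A p" "poly p x \<in> M"
  shows "coeff p i \<in> M"
proof (rule ccontr)
  assume "coeff p i \<notin> M"
  then obtain q where "poly_over A q" "\<And>j. coeff q j \<approx> coeff p j" "lead_coeff q \<notin> M"
    using poly_over_truncate assms(2) by metis
  then show False
    using assms poly_cong[of q p x] cong_mem_iff unfolding algebraic_mod_def by blast
qed

end

section \<open>Goldman's argument\<close>

text \<open>For transcendental \<open>x\<close>, \<open>adjoin A x\<close> behaves like a polynomial
  ring modulo \<open>M\<close>. There \<open>1 + x * g\<close> is coprime to \<open>g\<close>, yet
  it would have to divide a power of \<open>g\<close>.\<close>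

lemma goldman_adjoin_imp_algebraic:
  assumes A: "subring_over A" and "goldman (adjoin A x)"
  shows "algebraic_mod A x"
proof (rule ccontr)
  assume na: "\<not> algebraic_mod A x"
  obtain g where g: "g \<in> adjoin A x" "g \<notin> M"
    and gold: "\<And>b. b \<in> adjoin A x \<Longrightarrow> b \<notin> M \<Longrightarrow> \<exists>N. \<exists>c\<in>adjoin A x. g ^ N \<approx> b * c"
    using assms(2) unfolding goldman_def by auto
  obtain G0 where G0: "poly_over A G0" "g = poly G0 x"
    using g by (auto simp: adjoin_def)
  obtain i where "coeff G0 i \<notin> M"
    using poly_mem[of G0 x] g G0 by blast
  then obtain G where G: "poly_over A G" "\<And>j. coeff G j \<approx> coeff G0 j" "lead_coeff G \<notin> M"
    using poly_over_truncate[OF A G0(1)] by metis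
  have gG: "g \<approx> poly G x"
    using G poly_cong G0 cong_sym by blast
  define b where "b = 1 + x * poly G x"
  have b_poly: "b = poly (pCons 1 G) x"
    by (simp add: b_def)
  have over: "poly_over A (pCons 1 G)"
    by (intro poly_over_pCons[OF A] sub_one[OF A] G)
  have "b \<notin> M"
    using not_algebraic_coeffs[OF A na over, of 0] one_not_mem by (auto simp: b_poly)
  moreover have "b \<in> adjoin A x"
    using over unfolding adjoin_def b_poly by blast
  ultimately obtain N c where c: "c \<in> adjoin A x" "g ^ N \<approx> b * c"
    using gold by blast
  \<comment> \<open>Since \<open>- x * g \<equiv> 1\<close> modulo \<open>b\<close> and \<open>b\<close> divides a power of \<open>g\<close>, \<open>b\<close> is a unit
    of the polynomial ring, although its degree is positive.\<close>
  have Bsub: "subring_over (adjoin A x)"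
    by (rule subring_adjoin[OF A])
  have unit: "\<exists>u\<in>adjoin A x. (- x * poly G x) ^ n = 1 + b * u" for n
  proof (induction n)
    case 0
    then show ?case
      using sub_zero[OF Bsub] by (intro bexI[of _ 0]) auto
  next
    case (Suc n)
    then obtain u where u: "u \<in> adjoin A x" "(- x * poly G x) ^ n = 1 + b * u"
      by blast
    have "(- x * poly G x) ^ Suc n = (1 - b) * (1 + b * u)"
      using u by (simp add: b_def)
    also have "\<dots> = 1 + b * (u + - 1 + - (b * u))"
      by (simp add: algebra_simps)
    finally show ?case
      using u \<open>b \<in> adjoin A x\<close> sub_one[OF Bsub]
      by (intro bexI[of _ "u + - 1 + - (b * u)"] sub_add[OF Bsub] sub_uminus[OF Bsub] sub_mult[OF Bsub])
  qed
  obtain u where u: "u \<in> adjoin A x" "(- x * poly G x) ^ N = 1 + b * u"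
    using unit by blast
  have "(- x * poly G x) ^ N = (- x) ^ N * poly G x ^ N"
    by (rule power_mult_distrib)
  also have "\<dots> \<approx> (- x) ^ N * (b * c)"
    by (intro cong_mult cong_refl cong_trans[OF cong_power[OF cong_sym[OF gG]] c(2)])
  finally have "1 + b * u \<approx> (- x) ^ N * (b * c)"
    using u by simp
  then have "(- x) ^ N * (b * c) - (1 + b * u) \<in> M"
    using cong_sym unfolding cong_mod_def by blast
  then have v: "b * ((- x) ^ N * c + - u) - 1 \<in> M"
    by (simp add: algebra_simps)
  have "(- x) ^ N * c + - u \<in> adjoin A x"
    by (intro sub_add[OF Bsub] sub_mult[OF Bsub] sub_power[OF Bsub] sub_uminus[OF Bsub] adjoin_self[OF A] u c)
  then obtain U0 where U0: "poly_over A U0" "(- x) ^ N * c + - u = poly U0 x"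
    unfolding adjoin_def by blast
  have "poly U0 x \<notin> M"
    using one_not_mem diff_mem[OF mult_mem[of "poly U0 x" b] v] by (auto simp flip: U0(2))
  then obtain j where "coeff U0 j \<notin> M"
    using poly_mem by blast
  then obtain U where U: "poly_over A U" "\<And>j. coeff U j \<approx> coeff U0 j" "lead_coeff U \<notin> M"
    using poly_over_truncate[OF A U0(1)] by metis
  have "b * poly U x \<approx> b * poly U0 x"
    by (intro cong_mult cong_refl poly_cong U)
  also have "\<dots> \<approx> 1"
    using v unfolding cong_mod_def U0 .
  finally have "poly (pCons 1 G * U - 1) x \<in> M"
    by (simp add: cong_mod_def b_poly algebra_simps)
  moreover have "poly_over A (pCons 1 G * U - 1)"
    using poly_over_monom[OF A sub_one[OF A], of 0]
    by (intro poly_over_diff[OF A] poly_over_mult[OF A] over U) (simp add: monom_0 one_pCons)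
  \<comment> \<open>The index is the sum of the degrees of the two factors, with \<open>Suc\<close>
    coming from the factor \<open>x\<close> in \<open>b\<close>. It is positive, so subtracting 1
    does not affect this coefficient.\<close>
  ultimately have "coeff (pCons 1 G * U - 1) (Suc (degree G) + degree U) \<in> M"
    using not_algebraic_coeffs[OF A na] by blast
  moreover have "G \<noteq> 0"
    using G zero_mem by auto
  ultimately have "lead_coeff G * lead_coeff U \<in> M"
    using coeff_mult_degree_sum[of "pCons 1 G" U] by simp
  then show False
    using prime_mem G U by blast
qed

text \<open>The new denominator is \<open>f * e\<close>, where \<open>f\<close> is the leading
  coefficient of a minimal relation for \<open>x\<close>, and \<open>e\<close> is an element of
  \<open>A\<close> outside \<open>M\<close> congruent to a multiple of \<open>g\<close>. Inverting
  \<open>f\<close> makes \<open>x\<close> integral, and inverting \<open>e\<close> inverts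
  \<open>g\<close>.\<close>

lemma goldman_adjoin_imp_goldman:
  assumes A: "subring_over A" and gold_adjoin: "goldman (adjoin A x)"
  shows "goldman A"
proof -
  let ?B = "adjoin A x"
  have Bsub: "subring_over ?B"
    by (rule subring_adjoin[OF A])
  obtain g where g: "g \<in> ?B" "g \<notin> M"
    and gold: "\<And>b. b \<in> ?B \<Longrightarrow> b \<notin> M \<Longrightarrow> \<exists>N. \<exists>c\<in>?B. g ^ N \<approx> b * c"
    using assms(2) unfolding goldman_def by auto
  define is_rel where "is_rel F \<longleftrightarrow> poly_over A F \<and> poly F x \<in> M \<and> lead_coeff F \<notin> M" for F
  have "\<exists>F. is_rel F"
    using goldman_adjoin_imp_algebraic[OF A gold_adjoin] unfolding algebraic_mod_def is_rel_def .
  then obtain F where "is_rel F" and F_min: "\<And>P. is_rel P \<Longrightarrow> degree F \<le> degree P"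
    using ex_has_least_nat[of is_rel _ degree] by blast
  then have F: "poly_over A F" "poly F x \<in> M" "lead_coeff F \<notin> M"
    by (auto simp: is_rel_def)
  define d f where "d = degree F" and "f = lead_coeff F"
  have F0: "F \<noteq> 0"
    using F zero_mem by auto
  have f: "f \<in> A" "f \<notin> M"
    using F by (auto simp: f_def poly_over_def)
  have d: "d > 0"
  proof (rule ccontr)
    assume "\<not> d > 0"
    then obtain a where "F = [:a:]"
      using degree_eq_zeroE unfolding d_def by blast
    then show False
      using F by simp
  qed
  \<comment> \<open>Minimality of \<open>d\<close> makes the powers of \<open>x\<close> below
    \<open>d\<close> linearly independent over \<open>A\<close> modulo \<open>M\<close>.\<close>
  have indep: "coeff P i \<in> M" if P: "poly_over A P" "poly P x \<in> M" "degree P < d" for P i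
  proof (rule ccontr)
    assume "coeff P i \<notin> M"
    then obtain q where q: "poly_over A q" "\<And>j. coeff q j \<approx> coeff P j" "lead_coeff q \<notin> M"
      "degree q \<le> degree P"
      using poly_over_truncate[OF A] P(1) by metis
    then have "is_rel q"
      using poly_cong[of q P x] cong_mem_iff P unfolding is_rel_def by blast
    then show False
      using F_min[of q] q(4) P(3) by (simp add: d_def)
  qed
  \<comment> \<open>After multiplication by a power of \<open>f\<close>, division by
    \<open>F\<close> brings every element of \<open>?B\<close> into the span of these
    powers.\<close>
  have reduce: "\<exists>s Q. poly_over A Q \<and> degree Q < d \<and> f ^ s * poly P x \<approx> poly Q x"
    if P: "poly_over A P" for P
  proof -
    obtain s Q R where QR: "poly_over A Q" "poly_over A R" "smult (f ^ s) P = Q * F + R"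
      "R = 0 \<or> degree R < degree F"
      using pseudo_division_over[OF A F(1) F0 P] unfolding f_def by blast
    have "f ^ s * poly P x = poly Q x * poly F x + poly R x"
      using arg_cong[OF QR(3), of "\<lambda>p. poly p x"] by simp
    then have "f ^ s * poly P x \<approx> poly R x"
      using mult_mem[OF F(2)] by (simp add: cong_mod_def)
    moreover have "degree R < d"
      using QR(4) d by (auto simp: d_def)
    ultimately show ?thesis
      using QR by blast
  qed
  \<comment> \<open>A polynomial of least degree with value a nonzero multiple of \<open>g\<close> is constant,
    since its remainder in the division of \<open>F\<close> would otherwise be smaller.\<close>
  define is_mult where "is_mult H \<longleftrightarrow> poly_over A H \<and> lead_coeff H \<notin> M \<and> poly H x \<notin> M \<and>
    (\<exists>u\<in>?B. poly H x \<approx> g * u)" for H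
  have is_multI: "\<exists>H. is_mult H \<and> degree H \<le> degree P"
    if P: "poly_over A P" "poly P x \<notin> M" "\<exists>u\<in>?B. poly P x \<approx> g * u" for P
  proof -
    obtain i where "coeff P i \<notin> M"
      using P poly_mem by blast
    then obtain q where q: "poly_over A q" "\<And>j. coeff q j \<approx> coeff P j" "lead_coeff q \<notin> M"
      "degree q \<le> degree P"
      using poly_over_truncate[OF A] P(1) by metis
    have "poly q x \<approx> poly P x"
      by (intro poly_cong q)
    then show ?thesis
      using P q cong_mem_iff cong_trans unfolding is_mult_def by blast
  qed
  obtain G where G: "poly_over A G" "g = poly G x"
    using g by (auto simp: adjoin_def)
  have "poly G x \<approx> g * 1"
    using G by simp
  then have "\<exists>H. is_mult H"
    using is_multI[OF G(1)] g G sub_one[OF Bsub] by blast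
  then obtain H where "is_mult H" and H_min: "\<And>P. is_mult P \<Longrightarrow> degree H \<le> degree P"
    using ex_has_least_nat[of is_mult _ degree] by blast
  then obtain u where H: "poly_over A H" "lead_coeff H \<notin> M" "poly H x \<notin> M"
    and u: "u \<in> ?B" "poly H x \<approx> g * u"
    by (auto simp: is_mult_def)
  have H0: "H \<noteq> 0"
    using H zero_mem by auto
  have small: "poly P x \<in> M"
    if "poly_over A P" "degree P < degree H" "\<exists>v\<in>?B. poly P x \<approx> g * v" for P
    using is_multI[of P] H_min that by (meson leD le_less_trans)
  have poly_in: "poly P x \<in> ?B" if "poly_over A P" for P
    using that unfolding adjoin_def by blast
  \<comment> \<open>Otherwise reducing \<open>H\<close> by \<open>F\<close> gives a multiple of
    \<open>g\<close> of smaller degree, whose value is outside \<open>M\<close> because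
    \<open>f\<close> and the value of \<open>H\<close> are.\<close>
  have "degree H < d"
  proof (rule ccontr)
    assume "\<not> degree H < d"
    moreover obtain s Q where Q: "poly_over A Q" "degree Q < d" "f ^ s * poly H x \<approx> poly Q x"
      using reduce[OF H(1)] by blast
    moreover have "poly Q x \<approx> g * (f ^ s * u)"
      using cong_trans[OF cong_sym[OF Q(3)] cong_mult[OF cong_refl u(2)]] by (simp add: mult_ac)
    moreover have "f ^ s * u \<in> ?B"
      using f u adjoin_incl[OF A] by (intro sub_mult[OF Bsub] sub_power[OF Bsub]) auto
    ultimately have "poly Q x \<in> M"
      by (intro small) auto
    then have "f ^ s * poly H x \<in> M"
      using cong_mem_iff[OF Q(3)] by blast
    then show False
      using prime_mem power_not_mem f H by blast
  qed
  have "degree H = 0"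
  proof (rule ccontr)
    assume e: "degree H \<noteq> 0"
    obtain s Q R where QR: "poly_over A Q" "poly_over A R"
      "smult (lead_coeff H ^ s) F = Q * H + R" "R = 0 \<or> degree R < degree H"
      "degree Q \<le> degree F - degree H"
      using pseudo_division_over[OF A H(1) H0 F(1)] by blast
    have ev: "lead_coeff H ^ s * poly F x = poly Q x * poly H x + poly R x"
      using arg_cong[OF QR(3), of "\<lambda>p. poly p x"] by simp
    have sum_in: "poly Q x * poly H x + poly R x \<in> M"
      using ev mult_mem[OF F(2)] by metis
    have degR: "degree R < degree H"
      using QR(4) e by auto
    have "poly R x \<approx> - poly Q x * poly H x"
      using sum_in by (simp add: cong_mod_def add.commute)
    also have "\<dots> \<approx> - poly Q x * (g * u)"
      by (intro cong_mult cong_refl u)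
    finally have "poly R x \<approx> g * (- poly Q x * u)"
      by (simp add: mult_ac)
    moreover have "- poly Q x * u \<in> ?B"
      by (intro sub_mult[OF Bsub] sub_uminus[OF Bsub] poly_in QR u)
    ultimately have Rx: "poly R x \<in> M"
      using small[OF QR(2) degR] by blast
    then have "poly Q x * poly H x \<in> M"
      using diff_mem[OF sum_in Rx] by simp
    then have "poly Q x \<in> M"
      using prime_mem H by blast
    \<comment> \<open>Positive \<open>degree H\<close> gives \<open>degree Q < d\<close>, so
      independence applies to \<open>Q\<close> as well as to \<open>R\<close>. All coefficients of a
      power of \<open>lead_coeff H\<close> times \<open>F\<close> would then lie in
      \<open>M\<close>, even the top one.\<close>
    then have "coeff Q i \<in> M" for i
      using indep[OF QR(1)] QR(5) e d by (auto simp: d_def)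
    moreover have "coeff R i \<in> M" for i
      using indep[OF QR(2) Rx] degR \<open>degree H < d\<close> by auto
    ultimately have "coeff (Q * H + R) i \<in> M" for i
      by (auto simp: coeff_mult intro!: add_mem sum_mem mult_mem')
    then have "coeff (smult (lead_coeff H ^ s) F) d \<in> M"
      using QR(3) by simp
    then show False
      using prime_mem power_not_mem H F by (auto simp: d_def)
  qed
  then obtain e where "H = [:e:]"
    by (rule degree_eq_zeroE)
  then have e: "e \<in> A" "e \<notin> M" "e \<approx> g * u"
    using H u by (auto simp: poly_over_def dest: spec[of _ 0])
  \<comment> \<open>Multiplying an equation for \<open>g ^ N\<close> by \<open>u ^ N\<close>
    replaces \<open>g\<close> by \<open>e\<close>, and multiplying by \<open>f ^ s\<close> reduces
    the degree. Comparing constant coefficients then leads from \<open>?B\<close> back to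
    \<open>A\<close>.\<close>
  have "\<exists>N. \<exists>c\<in>A. (f * e) ^ N \<approx> b * c" if b: "b \<in> A" "b \<notin> M" for b
  proof -
    obtain N c where c: "c \<in> ?B" "g ^ N \<approx> b * c"
      using gold[of b] b adjoin_incl[OF A] by blast
    have "c * u ^ N \<in> ?B"
      by (intro sub_mult[OF Bsub] sub_power[OF Bsub] c u)
    then obtain C where C: "poly_over A C" "c * u ^ N = poly C x"
      unfolding adjoin_def by blast
    obtain s Q where Q: "poly_over A Q" "degree Q < d" "f ^ s * poly C x \<approx> poly Q x"
      using reduce[OF C(1)] by blast
    have "e ^ N \<approx> g ^ N * u ^ N"
      using cong_power[OF e(3), of N] by (simp add: power_mult_distrib)
    also have "\<dots> \<approx> (b * c) * u ^ N"
      by (intro cong_mult c cong_refl)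
    finally have "e ^ N \<approx> b * poly C x"
      by (simp add: C(2)[symmetric] mult_ac)
    then have "f ^ s * e ^ N \<approx> f ^ s * (b * poly C x)"
      by (intro cong_mult cong_refl)
    also have "\<dots> = b * (f ^ s * poly C x)"
      by (simp add: mult_ac)
    also have "\<dots> \<approx> b * poly Q x"
      by (intro cong_mult cong_refl Q)
    finally have "poly ([:f ^ s * e ^ N:] - smult b Q) x \<in> M"
      by (simp add: cong_mod_def)
    moreover have "poly_over A ([:f ^ s * e ^ N:] - smult b Q)"
      by (intro poly_over_diff[OF A] poly_over_smult[OF A] poly_over_pCons[OF A]
          poly_over_0[OF A] sub_mult[OF A] sub_power[OF A] b f e Q)
    moreover have "degree ([:f ^ s * e ^ N:] - smult b Q) < d"
      using d Q(2) degree_smult_le[of b Q] by (intro degree_diff_less) auto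
    ultimately have "coeff ([:f ^ s * e ^ N:] - smult b Q) 0 \<in> M"
      using indep by blast
    then have "f ^ s * e ^ N \<approx> b * coeff Q 0"
      by (simp add: cong_mod_def)
    \<comment> \<open>The extra factor balances the exponents \<open>s\<close> and \<open>N\<close>,
      giving a power of \<open>f * e\<close>.\<close>
    then have "(f ^ s * e ^ N) * (f ^ N * e ^ s) \<approx> (b * coeff Q 0) * (f ^ N * e ^ s)"
      by (rule cong_mult[OF _ cong_refl])
    then have "(f * e) ^ (s + N) \<approx> b * (coeff Q 0 * (f ^ N * e ^ s))"
      by (simp add: power_add power_mult_distrib mult_ac)
    moreover have "coeff Q 0 * (f ^ N * e ^ s) \<in> A"
      using Q(1) by (intro sub_mult[OF A] sub_power[OF A] f e) (simp add: poly_over_def)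
    ultimately show ?thesis
      by blast
  qed
  moreover have "f * e \<in> A - M"
    using f e prime_mem sub_mult[OF A] by auto
  ultimately show ?thesis
    unfolding goldman_def by blast
qed

text \<open>Adjoin the generators one at a time until the subring is the whole ring, where the
  property is just invertibility modulo \<open>M\<close>; then descend again by the previous
  lemma.\<close>

lemma goldman_of_generated:
  assumes "finite S" "subring_over A"
    and "\<And>B. subring_over B \<Longrightarrow> A \<subseteq> B \<Longrightarrow> S \<subseteq> B \<Longrightarrow> B = UNIV"
  shows "goldman A"
  using assms
proof (induction S arbitrary: A rule: finite_induct)
  case empty
  then have "A = UNIV"
    by blast
  moreover have "\<exists>N c. 1 ^ N \<approx> b * c" if "b \<notin> M" for b
    using inverse_mod[OF that] by (auto simp: cong_mod_def mult.commute)
  ultimately show ?case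
    unfolding goldman_def using one_not_mem by blast
next
  case (insert x S)
  have "goldman (adjoin A x)"
  proof (rule insert.IH)
    show "subring_over (adjoin A x)"
      by (rule subring_adjoin[OF insert.prems(1)])
    fix B assume "subring_over B" "adjoin A x \<subseteq> B" "S \<subseteq> B"
    then show "B = UNIV"
      using insert.prems(2)[of B] adjoin_incl[OF insert.prems(1)] adjoin_self[OF insert.prems(1)]
      by blast
  qed
  then show ?case
    by (rule goldman_adjoin_imp_goldman[OF insert.prems(1)])
qed

text \<open>Goldman's property for \<open>adjoin k y\<close> makes \<open>y\<close> algebraic over
  the scalars modulo \<open>M\<close>. Over an algebraically closed field the relation splits into
  linear factors, one of which vanishes at \<open>y\<close> modulo the prime ideal
  \<open>M\<close>.\<close>

theorem weak_nullstellensatz: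
  fixes \<phi> :: "'k::field \<Rightarrow> 'r"
  assumes ac: "alg_closed TYPE('k)" and hom: "is_ring_hom \<phi>"
    and fg: "finitely_generated_algebra \<phi>"
  shows "\<exists>c. y - \<phi> c \<in> M"
proof -
  have phi_1: "\<phi> 1 = 1" and phi_add: "\<phi> (a + b) = \<phi> a + \<phi> b"
    and phi_mult: "\<phi> (a * b) = \<phi> a * \<phi> b" for a b
    using hom by (auto simp: is_ring_hom_def)
  have phi_0: "\<phi> 0 = 0"
    using phi_add[of 0 0] by simp
  have phi_uminus: "\<phi> (- a) = - \<phi> a" for a
    using phi_add[of a "- a"] phi_0 by (simp add: eq_neg_iff_add_eq_0 add.commute)
  have phi_diff: "\<phi> (a - b) = \<phi> a - \<phi> b" for a b
    using phi_add[of a "- b"] by (simp add: phi_uminus)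
  define k where "k = {a. \<exists>c. a \<approx> \<phi> c}"
  have k: "subring_over k"
    unfolding subring_over_def
  proof (intro conjI ballI)
    show "M \<subseteq> k"
      using phi_0 by (auto simp: k_def cong_mod_def intro: exI[of _ 0])
    show "1 \<in> k"
      using phi_1 cong_refl unfolding k_def by (metis mem_Collect_eq)
    show "- a \<in> k" if a: "a \<in> k" for a
    proof -
      obtain c where "a \<approx> \<phi> c"
        using a unfolding k_def by blast
      then have "- 1 * a \<approx> - 1 * \<phi> c"
        by (intro cong_mult cong_refl)
      then show ?thesis
        using phi_uminus[of c] by (auto simp: k_def intro!: exI[of _ "- c"])
    qed
    fix a b assume "a \<in> k" "b \<in> k"
    then obtain c d where "a \<approx> \<phi> c" "b \<approx> \<phi> d"
      unfolding k_def by blast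
    then have "a + b \<approx> \<phi> (c + d)" "a * b \<approx> \<phi> (c * d)"
      by (auto simp: phi_add phi_mult intro: cong_add cong_mult)
    then show "a + b \<in> k" "a * b \<in> k"
      unfolding k_def by blast+
  qed
  obtain S where S: "finite S" "alg_generated \<phi> S = UNIV"
    using fg by (auto simp: finitely_generated_algebra_def)
  \<comment> \<open>The descent stops at \<open>adjoin k y\<close> rather than \<open>k\<close>, so
    that the first Goldman lemma applies to \<open>y\<close>, which need not be among the
    generators.\<close>
  have "goldman (adjoin k y)"
  proof (rule goldman_of_generated[OF S(1)])
    show "subring_over (adjoin k y)"
      by (rule subring_adjoin[OF k])
    fix B assume B: "subring_over B" "adjoin k y \<subseteq> B" "S \<subseteq> B"
    have scalar: "\<phi> c \<in> B" for c
      using B(2) adjoin_incl[OF k, of y] cong_refl[of "\<phi> c"] unfolding k_def by blast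
    have "x \<in> B" if gen: "x \<in> alg_generated \<phi> S" for x
      using gen by (induction rule: alg_generated.induct)
        (use scalar B(3) sub_add[OF B(1)] sub_mult[OF B(1)] in auto)
    then show "B = UNIV"
      using S by auto
  qed
  then have "algebraic_mod k y"
    by (rule goldman_adjoin_imp_algebraic[OF k])
  then obtain F where F: "poly_over k F" "poly F y \<in> M" "lead_coeff F \<notin> M"
    unfolding algebraic_mod_def by blast
  define ev where "ev p = poly (map_poly \<phi> p) y" for p
  have coeff_ev: "coeff (map_poly \<phi> p) i = \<phi> (coeff p i)" for p i
    by (simp add: coeff_map_poly phi_0)
  \<comment> \<open>The coefficients of \<open>F\<close> are only congruent to scalars; lifting them
    gives a genuine polynomial over the field.\<close>
  have lift: "\<exists>P. \<forall>i. coeff F i \<approx> \<phi> (coeff P i)" if "poly_over k F" for F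
    using that
  proof (induction F)
    case 0
    then show ?case
      by (intro exI[of _ 0]) (simp add: phi_0)
  next
    case (pCons a F)
    have a: "a \<in> k" and "poly_over k F"
      using pCons.prems by (auto simp: poly_over_def coeff_pCons split: nat.splits
        dest: spec[of _ 0] spec[of _ "Suc _"])
    then obtain P c where "\<forall>i. coeff F i \<approx> \<phi> (coeff P i)" "a \<approx> \<phi> c"
      using pCons.IH by (auto simp: k_def)
    then show ?case
      by (intro exI[of _ "pCons c P"]) (auto simp: coeff_pCons split: nat.split)
  qed
  obtain P where P: "\<And>i. coeff F i \<approx> \<phi> (coeff P i)"
    using lift[OF F(1)] by blast
  have "poly F y \<approx> ev P"
    unfolding ev_def by (intro poly_cong) (simp add: P coeff_ev)
  then have "ev P \<in> M"
    using F(2) cong_mem_iff by blast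
  moreover have "P \<noteq> 0"
    using P[of "degree F"] F(3) cong_mem_iff zero_mem by (auto simp: phi_0)
  ultimately show ?thesis
  \<comment> \<open>Either the linear factor of a root has its value in \<open>M\<close>, or the
    cofactor is a nonzero polynomial of smaller degree with value in \<open>M\<close>. Nonzero
    constants are impossible because they are units.\<close>
  proof (induction "degree P" arbitrary: P rule: less_induct)
    case less
    show ?case
    proof (cases "degree P \<ge> 1")
      case True
      then obtain r where "poly P r = 0"
        using ac unfolding alg_closed_def by blast
      then obtain Q where Q: "P = [:- r, 1:] * Q"
        by (auto simp: poly_eq_0_iff_dvd)
      have "map_poly \<phi> P = [:- \<phi> r, 1:] * map_poly \<phi> Q"
        by (rule poly_eqI) (auto simp: Q coeff_ev coeff_pCons phi_0 phi_diff phi_mult phi_uminus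
            split: nat.split)
      then have evP: "ev P = (y - \<phi> r) * ev Q"
        by (simp add: ev_def left_diff_distrib)
      have "Q \<noteq> 0"
        using less.prems Q by auto
      then have "degree Q < degree P"
        unfolding Q by (subst degree_mult_eq) auto
      then show ?thesis
        using less.hyps[of Q] \<open>Q \<noteq> 0\<close> less.prems(1) evP prime_mem by auto
    next
      case False
      then obtain c where c: "P = [:c:]"
        using degree_eq_zeroE by (metis One_nat_def not_less_eq_eq le_zero_eq not_less_zero
          bot_nat_0.extremum_unique)
      then have "ev P = \<phi> c" "c \<noteq> 0"
        using less.prems by (auto simp: ev_def map_poly_pCons phi_0)
      then have "\<phi> (inverse c) * \<phi> c \<in> M"
        using less.prems mult_mem by simp
      then show ?thesis
        using \<open>c \<noteq> 0\<close> one_not_mem by (simp add: phi_mult[symmetric] phi_1)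
    qed
  qed
qed

end

section \<open>Koszul complexes\<close>

text \<open>The basis of the longer complex splits into the elements without and with the last
  index, the two summands of the mapping cone.\<close>

lemma subset_Suc_cases:
  assumes "J \<subseteq> {..<Suc n}"
  obtains "J \<subseteq> {..<n}" | K where "J = insert n K" "K \<subseteq> {..<n}"
proof (cases "n \<in> J")
  case True
  then show ?thesis
    using assms by (intro that(2)[of "J - {n}"]) (auto simp: less_Suc_eq)
next
  case False
  then show ?thesis
    using assms by (intro that(1)) (auto simp: less_Suc_eq)
qed

context module
begin

section \<open>The Koszul differential as that of a mapping cone\<close>

lemma koszul_diff_cong:
  assumes "\<And>I. I \<subseteq> {..<length y} \<Longrightarrow> c I = d I"
  shows "koszul_diff scale y c = koszul_diff scale y d"
  unfolding koszul_diff_def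
  by (intro ext if_cong refl sum.cong arg_cong2[of _ _ _ _ scale] assms) auto

lemma koszul_diff_0: "koszul_diff scale y (\<lambda>_. 0) = (\<lambda>_. 0)"
  by (auto simp: koszul_diff_def)

lemma koszul_diff_add:
  "koszul_diff scale y (\<lambda>I. c I + d I) = (\<lambda>J. koszul_diff scale y c J + koszul_diff scale y d J)"
  by (auto simp: koszul_diff_def scale_right_distrib sum.distrib)

lemma koszul_diff_scale:
  "koszul_diff scale y (\<lambda>I. scale r (c I)) = (\<lambda>J. scale r (koszul_diff scale y c J))"
  by (auto simp: koszul_diff_def scale_sum_right mult.commute)

text \<open>Adding an index to \<open>J\<close> changes the parity of its cardinality. The sign thus
  turns multiplication by \<open>t\<close> into a map that anticommutes with the
  differential.\<close>

lemma koszul_diff_sign: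
  "koszul_diff scale y (\<lambda>I. scale ((-1) ^ card I * t) (c I)) =
    (\<lambda>J. - scale ((-1) ^ card J * t) (koszul_diff scale y c J))"
proof
  fix J
  show "koszul_diff scale y (\<lambda>I. scale ((-1) ^ card I * t) (c I)) J =
    - scale ((-1) ^ card J * t) (koszul_diff scale y c J)"
  proof (cases "J \<subseteq> {..<length y}")
    case True
    then have fin: "finite J"
      using finite_subset by blast
    show ?thesis
      using True fin
      by (auto simp: koszul_diff_def scale_sum_right sum_negf[symmetric] algebra_simps
          simp flip: scale_minus_left intro!: sum.cong)
  qed (auto simp: koszul_diff_def)
qed

text \<open>All elements of \<open>J\<close> precede the new index, which explains the sign of the
  \<open>t\<close>-term.\<close>

lemma koszul_diff_snoc:
  assumes "J \<subseteq> {..<length y}"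
  shows "koszul_diff scale (y @ [t]) c J =
    koszul_diff scale y c J + scale ((-1) ^ card J * t) (c (insert (length y) J))"
proof -
  have J: "{j \<in> J. j < length y} = J" "J \<subseteq> {..<Suc (length y)}"
    using assms by auto
  have "{..<Suc (length y)} - J = insert (length y) ({..<length y} - J)"
    using assms by auto
  then show ?thesis
    using assms J by (auto simp: koszul_diff_def nth_append add.commute intro!: sum.cong)
qed

text \<open>No \<open>t\<close>-term occurs, since the new index cannot be added twice; being the
  largest, it leaves the other signs unchanged.\<close>

lemma koszul_diff_snoc_insert:
  assumes J: "J \<subseteq> {..<length y}"
  shows "koszul_diff scale (y @ [t]) c (insert (length y) J) =
    koszul_diff scale y (\<lambda>I. c (insert (length y) I)) J"
proof -
  have "{..<Suc (length y)} - insert (length y) J = {..<length y} - J"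
    using J by auto
  moreover have "{j. (j = length y \<or> j \<in> J) \<and> j < i} = {j \<in> J. j < i}"
    if "i < length y" for i
    using that by auto
  moreover have "insert (length y) J \<subseteq> {..<Suc (length y)}"
    using J by auto
  ultimately show ?thesis
    using J by (auto simp: koszul_diff_def nth_append insert_commute intro!: sum.cong)
qed

lemma koszul_diff_outside: "\<not> J \<subseteq> {..<length y} \<Longrightarrow> koszul_diff scale y c J = 0"
  by (simp add: koszul_diff_def)

text \<open>By induction along the tuple: the two mixed terms of the cone cancel by
  \<open>koszul_diff_sign\<close>.\<close>

lemma koszul_diff_diff: "koszul_diff scale y (koszul_diff scale y c) = (\<lambda>_. 0)"
proof (induction y arbitrary: c rule: rev_induct)
  case Nil
  then show ?case
    by (auto simp: koszul_diff_def)
next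
  case (snoc t y)
  let ?n = "length y" and ?d = "koszul_diff scale y" and ?D = "koszul_diff scale (y @ [t])"
  define c1 where "c1 I = c (insert ?n I)" for I
  show ?case
  proof
    fix J
    consider "J \<subseteq> {..<?n}" | K where "J = insert ?n K" "K \<subseteq> {..<?n}" | "\<not> J \<subseteq> {..<Suc ?n}"
      using subset_Suc_cases by metis
    then show "?D (?D c) J = 0"
    proof cases
      case 1
      have "?d (?D c) J = ?d (\<lambda>I. ?d c I + scale ((-1) ^ card I * t) (c1 I)) J"
        by (rule fun_cong[OF koszul_diff_cong]) (simp add: koszul_diff_snoc c1_def)
      then have "?d (?D c) J = - scale ((-1) ^ card J * t) (?d c1 J)"
        by (simp add: koszul_diff_add koszul_diff_sign snoc.IH)
      moreover have "?D c (insert ?n J) = ?d c1 J"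
        using 1 by (simp add: koszul_diff_snoc_insert c1_def[abs_def])
      ultimately show ?thesis
        using 1 by (simp add: koszul_diff_snoc)
    next
      case 2
      have "?d (\<lambda>I. ?D c (insert ?n I)) K = ?d (?d c1) K"
        by (rule fun_cong[OF koszul_diff_cong]) (simp add: koszul_diff_snoc_insert c1_def[abs_def])
      then show ?thesis
        using 2 by (simp add: koszul_diff_snoc_insert snoc.IH)
    qed (simp add: koszul_diff_outside)
  qed
qed

lemma koszul_diff_chains:
  assumes "c \<in> koszul_chains (length y) (Suc p)"
  shows "koszul_diff scale y c \<in> koszul_chains (length y) p"
  unfolding koszul_chains_def
proof (intro CollectI allI impI)
  fix J assume nz: "koszul_diff scale y c J \<noteq> 0"
  then have J: "J \<subseteq> {..<length y}"
    using koszul_diff_outside by blast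
  then have "\<exists>i\<in>{..<length y} - J. scale ((-1) ^ card {j\<in>J. j < i} * y ! i) (c (insert i J)) \<noteq> 0"
    using nz sum.neutral unfolding koszul_diff_def by (smt (verit))
  then obtain i where i: "i \<notin> J" "c (insert i J) \<noteq> 0"
    by (metis DiffD2 scale_zero_right)
  have "finite J"
    using J finite_subset by blast
  then show "J \<subseteq> {..<length y} \<and> card J = p"
    using i J assms unfolding koszul_chains_def by fastforce
qed

section \<open>Exactness and the passage from \<open>y\<close> to \<open>y @ [t]\<close>\<close>

lemma boundaries_subset_cycles:
  "koszul_diff scale y ` koszul_chains (length y) (Suc p) \<subseteq>
    {c \<in> koszul_chains (length y) p. koszul_diff scale y c = (\<lambda>_. 0)}"
  using koszul_diff_chains koszul_diff_diff by blast

text \<open>Removes the bound on \<open>p\<close>: above \<open>length y\<close> every chain is zero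
  and hence a boundary.\<close>

lemma koszul_exactD:
  assumes ex: "koszul_exact scale y" and c: "c \<in> koszul_chains (length y) p"
    and cyc: "koszul_diff scale y c = (\<lambda>_. 0)"
  shows "\<exists>w\<in>koszul_chains (length y) (Suc p). koszul_diff scale y w = c"
proof (cases "p \<le> length y")
  case True
  then have "{c \<in> koszul_chains (length y) p. koszul_diff scale y c = (\<lambda>_. 0)} =
      koszul_diff scale y ` koszul_chains (length y) (Suc p)"
    using ex by (simp only: koszul_exact_def)
  then have "c \<in> koszul_diff scale y ` koszul_chains (length y) (Suc p)"
    using c cyc by blast
  then show ?thesis
    by (metis imageE)
next
  case False
  have "c I = 0" for I
  proof (rule ccontr)
    assume "c I \<noteq> 0"
    then have "I \<subseteq> {..<length y}" "card I = p"
      using c by (auto simp: koszul_chains_def)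
    then show False
      using False card_mono[of "{..<length y}" I] by simp
  qed
  then show ?thesis
    by (intro bexI[of _ "\<lambda>_. 0"]) (auto simp: koszul_diff_0 koszul_chains_def)
qed

lemma koszul_exact_iff:
  "koszul_exact scale y \<longleftrightarrow> (\<forall>p c. c \<in> koszul_chains (length y) p \<longrightarrow>
    koszul_diff scale y c = (\<lambda>_. 0) \<longrightarrow>
    (\<exists>w\<in>koszul_chains (length y) (Suc p). koszul_diff scale y w = c))"
  (is "?L \<longleftrightarrow> ?R")
proof
  assume ?R
  then show ?L
    unfolding koszul_exact_def using boundaries_subset_cycles[of y] by blast
qed (blast dest: koszul_exactD)

text \<open>A cycle of the cone is filled in two stages: first its component at the last index, then
  the rest, which after a correction is a cycle of \<open>Kos(y)\<close>.\<close>

lemma koszul_exact_snoc: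
  assumes ex: "koszul_exact scale y"
  shows "koszul_exact scale (y @ [t])"
  unfolding koszul_exact_iff
proof (intro allI impI)
  let ?n = "length y" and ?d = "koszul_diff scale y" and ?D = "koszul_diff scale (y @ [t])"
  fix p and c :: "nat set \<Rightarrow> 'b"
  assume c: "c \<in> koszul_chains (length (y @ [t])) p" and cyc: "?D c = (\<lambda>_. 0)"
  define c1 where "c1 I = (if I \<subseteq> {..<?n} then c (insert ?n I) else 0)" for I
  have cD: "I \<subseteq> {..<Suc ?n}" "card I = p" if "c I \<noteq> 0" for I
    using c that by (auto simp: koszul_chains_def)
  have dc1: "?d c1 = (\<lambda>_. 0)"
  proof
    fix J
    show "?d c1 J = 0"
    proof (cases "J \<subseteq> {..<?n}")
      case True
      then have "?d c1 J = ?D c (insert ?n J)"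
        unfolding koszul_diff_snoc_insert[OF True]
        by (intro fun_cong[OF koszul_diff_cong]) (simp add: c1_def)
      then show ?thesis
        using cyc by simp
    qed (rule koszul_diff_outside)
  qed
  have c1D: "I \<subseteq> {..<?n}" "Suc (card I) = p" if "c1 I \<noteq> 0" for I
  proof -
    show I: "I \<subseteq> {..<?n}"
      using that by (auto simp: c1_def split: if_splits)
    then have "finite I" "?n \<notin> I"
      using finite_subset by auto
    then show "Suc (card I) = p"
      using that I cD(2)[of "insert ?n I"] by (simp add: c1_def)
  qed
  obtain w1 where w1: "w1 \<in> koszul_chains ?n p" "?d w1 = c1"
  \<comment> \<open>\<open>c1\<close> has degree \<open>p - 1\<close>; for \<open>p = 0\<close> it
    vanishes, since no set containing the last index is empty.\<close>
  proof (cases p)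
    case 0
    then have "c1 = (\<lambda>_. 0)"
      using c1D by fastforce
    then show ?thesis
      using that[of "\<lambda>_. 0"] by (auto simp: koszul_diff_0 koszul_chains_def)
  next
    case (Suc q)
    then have "c1 \<in> koszul_chains ?n q"
      using c1D by (auto simp: koszul_chains_def)
    then show ?thesis
      using koszul_exactD[OF ex _ dc1] that Suc by blast
  qed
  \<comment> \<open>This subtracts the \<open>t\<close>-term that \<open>w1\<close>, placed at the
    last index, contributes to the boundary.\<close>
  define c0 where "c0 I = (if I \<subseteq> {..<?n} then c I + scale ((-1) ^ card I * (- t)) (w1 I) else 0)" for I
  have "c0 \<in> koszul_chains ?n p"
    using w1(1) cD by (force simp: koszul_chains_def c0_def)
  moreover have "?d c0 = (\<lambda>_. 0)"
  proof
    fix J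
    show "?d c0 J = 0"
    proof (cases "J \<subseteq> {..<?n}")
      case True
      have "?d c0 J = ?d (\<lambda>I. c I + scale ((-1) ^ card I * (- t)) (w1 I)) J"
        by (intro fun_cong[OF koszul_diff_cong]) (simp add: c0_def)
      also have "\<dots> = ?d c J - scale ((-1) ^ card J * (- t)) (c1 J)"
        by (simp only: koszul_diff_add koszul_diff_sign w1 diff_conv_add_uminus)
      also have "\<dots> = ?D c J"
        using True by (simp add: koszul_diff_snoc c1_def)
      finally show ?thesis
        using cyc by simp
    qed (rule koszul_diff_outside)
  qed
  ultimately obtain w0 where w0: "w0 \<in> koszul_chains ?n (Suc p)" "?d w0 = c0"
    using koszul_exactD[OF ex] by blast
  define w where "w I = (if ?n \<in> I then w1 (I - {?n}) else w0 I)" for I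
  have "w \<in> koszul_chains (length (y @ [t])) (Suc p)"
    unfolding koszul_chains_def
  proof (intro CollectI allI impI)
    fix I assume nz: "w I \<noteq> 0"
    show "I \<subseteq> {..<length (y @ [t])} \<and> card I = Suc p"
    proof (cases "?n \<in> I")
      case True
      then have I: "I - {?n} \<subseteq> {..<?n}" "card (I - {?n}) = p"
        using nz w1(1) by (auto simp: w_def koszul_chains_def)
      then have "finite I"
        using finite_subset by fastforce
      then show ?thesis
        using I True card_Suc_Diff1[of I ?n] by (auto simp: less_Suc_eq)
    next
      case False
      then show ?thesis
        using nz w0(1) by (fastforce simp: w_def koszul_chains_def)
    qed
  qed
  moreover have "?D w = c"
  proof
    fix J
    consider "J \<subseteq> {..<?n}" | K where "J = insert ?n K" "K \<subseteq> {..<?n}" | "\<not> J \<subseteq> {..<Suc ?n}"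
      using subset_Suc_cases by metis
    then show "?D w J = c J"
    proof cases
      case 1
      have "?d w J = ?d w0 J"
        by (intro fun_cong[OF koszul_diff_cong]) (auto simp: w_def)
      moreover have "insert ?n J - {?n} = J"
        using 1 by auto
      ultimately show ?thesis
        using 1 w0 by (simp add: koszul_diff_snoc w_def c0_def)
    next
      case 2
      have "?d (\<lambda>I. w (insert ?n I)) K = ?d w1 K"
      proof (intro fun_cong[OF koszul_diff_cong])
        fix I assume "I \<subseteq> {..<?n}"
        then have "insert ?n I - {?n} = I"
          by auto
        then show "w (insert ?n I) = w1 I"
          by (simp add: w_def)
      qed
      then show ?thesis
        using 2 w1 by (simp add: koszul_diff_snoc_insert c1_def)
    next
      case 3
      then show ?thesis
        using cD(1)[of J] koszul_diff_outside[of J "y @ [t]"] by auto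
    qed
  qed
  ultimately show "\<exists>w\<in>koszul_chains (length (y @ [t])) (Suc p). ?D w = c"
    by blast
qed

text \<open>A cycle \<open>z\<close> of \<open>Kos(y)\<close> is also a cycle of the cone. A chain
  bounded by \<open>z\<close> splits into \<open>b\<close> and, up to sign, \<open>u\<close>, and
  the cone formula gives the decomposition.\<close>

lemma koszul_exact_snoc_surj:
  assumes ex: "koszul_exact scale (y @ [t])"
    and z: "z \<in> koszul_chains (length y) p" "koszul_diff scale y z = (\<lambda>_. 0)"
  shows "\<exists>u b. u \<in> koszul_chains (length y) p \<and> koszul_diff scale y u = (\<lambda>_. 0) \<and>
    b \<in> koszul_chains (length y) (Suc p) \<and> z = (\<lambda>I. scale t (u I) + koszul_diff scale y b I)"
proof -
  let ?n = "length y" and ?d = "koszul_diff scale y" and ?D = "koszul_diff scale (y @ [t])"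
  have zD: "I \<subseteq> {..<?n}" "card I = p" if "z I \<noteq> 0" for I
    using z that by (auto simp: koszul_chains_def)
  then have z_insert: "z (insert ?n I) = 0" for I
    by blast
  have "z \<in> koszul_chains (length (y @ [t])) p"
    using zD by (force simp: koszul_chains_def)
  moreover have "?D z = (\<lambda>_. 0)"
  proof
    fix J
    consider "J \<subseteq> {..<?n}" | K where "J = insert ?n K" "K \<subseteq> {..<?n}" | "\<not> J \<subseteq> {..<Suc ?n}"
      using subset_Suc_cases by metis
    then show "?D z J = 0"
      by cases (auto simp: koszul_diff_snoc koszul_diff_snoc_insert z z_insert koszul_diff_0
          koszul_diff_outside)
  qed
  ultimately obtain w where w: "w \<in> koszul_chains (length (y @ [t])) (Suc p)" "?D w = z"
    using koszul_exactD[OF ex] by blast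
  have wD: "card I = Suc p" if "w I \<noteq> 0" for I
    using w that by (auto simp: koszul_chains_def)
  \<comment> \<open>The cone formula carries the sign \<open>(-1) ^ card J\<close>. Wherever the
    component is nonzero, \<open>card J = p\<close>, so the constant sign absorbs it and still
    commutes with the differential.\<close>
  define u where "u I = (if I \<subseteq> {..<?n} then scale ((-1) ^ p) (w (insert ?n I)) else 0)" for I
  define b where "b I = (if I \<subseteq> {..<?n} then w I else 0)" for I
  have uD: "card I = p" if I: "I \<subseteq> {..<?n}" "w (insert ?n I) \<noteq> 0" for I
  proof -
    have "finite I" "?n \<notin> I"
      using I finite_subset by auto
    then show ?thesis
      using wD[OF I(2)] by simp
  qed
  have "u \<in> koszul_chains ?n p"
    unfolding koszul_chains_def u_def using uD scale_zero_right by (smt (verit) mem_Collect_eq)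
  moreover have "b \<in> koszul_chains ?n (Suc p)"
    using wD by (auto simp: koszul_chains_def b_def split: if_splits)
  moreover have "?d u = (\<lambda>_. 0)"
  proof
    fix J
    show "?d u J = 0"
    proof (cases "J \<subseteq> {..<?n}")
      case True
      have "?d u J = ?d (\<lambda>I. scale ((-1) ^ p) (w (insert ?n I))) J"
        by (intro fun_cong[OF koszul_diff_cong]) (simp add: u_def)
      also have "\<dots> = scale ((-1) ^ p) (?D w (insert ?n J))"
        by (simp add: koszul_diff_scale koszul_diff_snoc_insert[OF True])
      finally show ?thesis
        by (simp add: w z_insert)
    qed (rule koszul_diff_outside)
  qed
  moreover have "z = (\<lambda>I. scale t (u I) + ?d b I)"
  proof
    fix J
    show "z J = scale t (u J) + ?d b J"
    proof (cases "J \<subseteq> {..<?n}")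
      case True
      have "?d b J = ?d w J"
        by (intro fun_cong[OF koszul_diff_cong]) (simp add: b_def)
      moreover have "scale ((-1) ^ card J * t) (w (insert ?n J)) = scale t (u J)"
        using uD[OF True] True by (cases "w (insert ?n J) = 0") (auto simp: u_def mult.commute)
      ultimately show ?thesis
        using koszul_diff_snoc[OF True, of t w] w by (simp add: add.commute)
    next
      case False
      then show ?thesis
        using zD(1)[of J] by (auto simp: u_def koszul_diff_outside)
    qed
  qed
  ultimately show ?thesis
    by blast
qed

end

section \<open>Subquotients of Noetherian modules\<close>

text \<open>Zorn's lemma applies because the union of a chain is finitely generated and hence equals
  a member of the chain, which keeps it properly inside \<open>Z\<close>.\<close>

lemma noetherian_maximal_submodule:
  assumes noeth: "noetherian_module scale"
    and Z: "module.subspace scale Z" and B: "module.subspace scale B" "B \<subset> Z"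
  obtains N where "module.subspace scale N" "B \<subseteq> N" "N \<subset> Z"
    "\<And>N'. module.subspace scale N' \<Longrightarrow> N \<subset> N' \<Longrightarrow> N' \<subseteq> Z \<Longrightarrow> N' = Z"
proof -
  interpret module scale
    using noeth by (simp add: noetherian_module_def)
  define \<A> where "\<A> = {N. subspace N \<and> B \<subseteq> N \<and> N \<subset> Z}"
  have "B \<in> \<A>"
    using B by (simp add: \<A>_def)
  then have "\<A> \<noteq> {}"
    by blast
  then obtain N where N: "N \<in> \<A>" "\<And>X. X \<in> \<A> \<Longrightarrow> N \<subseteq> X \<Longrightarrow> X = N"
  proof (rule subset_Zorn_nonempty[of \<A>, THEN bexE])
    fix C assume C: "C \<noteq> {}" "subset.chain \<A> C"
    have sub: "subspace X" if "X \<in> C" for X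
      using C that by (auto simp: subset_chain_def \<A>_def)
    have "subspace (\<Union>C)"
      unfolding subspace_def
    proof (intro conjI ballI allI)
      show "0 \<in> \<Union>C"
        using C(1) sub subspace_0 by blast
      show "x + z \<in> \<Union>C" if xz: "x \<in> \<Union>C" "z \<in> \<Union>C" for x z
      proof -
        obtain X Y where XY: "X \<in> C" "x \<in> X" "Y \<in> C" "z \<in> Y"
          using xz by blast
        then have "X \<subseteq> Y \<or> Y \<subseteq> X"
          using C(2) by (auto simp: subset_chain_def)
        then show ?thesis
          using XY sub subspace_add by (metis UnionI subsetD)
      qed
      show "scale r x \<in> \<Union>C" if "x \<in> \<Union>C" for r x
        using that sub subspace_scale by blast
    qed
    then obtain F where F: "finite F" "F \<subseteq> \<Union>C" "span F = \<Union>C"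
      using noeth unfolding noetherian_module_def by blast
    then obtain X where X: "X \<in> C" "F \<subseteq> X"
      using finite_subset_Union_chain[of F C \<A>] C by blast
    then have "\<Union>C \<subseteq> X"
      using F(3) span_minimal sub by blast
    then have "\<Union>C = X"
      using X by blast
    then show "\<Union>C \<in> \<A>"
      using X C by (auto simp: subset_chain_def)
  qed blast+
  show ?thesis
  proof
    show "subspace N" "B \<subseteq> N" "N \<subset> Z"
      using N by (auto simp: \<A>_def)
    fix N' assume "subspace N'" "N \<subset> N'" "N' \<subseteq> Z"
    then show "N' = Z"
      using N by (auto simp: \<A>_def)
  qed
qed

text \<open>The simple quotient \<open>Z / N\<close> is generated by one element \<open>z\<close>,
  whose annihilator is a maximal ideal. It contains some \<open>t - \<phi> c\<close>, which
  therefore maps \<open>Z\<close> into \<open>N\<close> and misses \<open>z\<close>, even modulo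
  \<open>B\<close>.\<close>

lemma noetherian_subquotient_not_surj:
  fixes \<phi> :: "'k::field \<Rightarrow> 'r::comm_ring_1" and scale :: "'r \<Rightarrow> 'm::ab_group_add \<Rightarrow> 'm"
  assumes alg: "alg_closed TYPE('k)" "is_ring_hom \<phi>" "finitely_generated_algebra \<phi>"
    and noeth: "noetherian_module scale"
    and Z: "module.subspace scale Z" and B: "module.subspace scale B" "B \<subset> Z"
  shows "\<exists>c. \<exists>z\<in>Z. \<forall>u\<in>Z. \<forall>b\<in>B. z \<noteq> scale (t - \<phi> c) u + b"
proof -
  interpret module scale
    using noeth by (simp add: noetherian_module_def)
  obtain N where N: "subspace N" "B \<subseteq> N" "N \<subset> Z"
    and N_max: "\<And>N'. subspace N' \<Longrightarrow> N \<subset> N' \<Longrightarrow> N' \<subseteq> Z \<Longrightarrow> N' = Z"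
    using noetherian_maximal_submodule[OF noeth Z B] by blast
  obtain z where z: "z \<in> Z" "z \<notin> N"
    using N(3) by blast
  \<comment> \<open>By maximality of \<open>N\<close>, every element of \<open>Z\<close> outside
    \<open>N\<close> generates \<open>Z\<close> modulo \<open>N\<close>.\<close>
  have gen: "\<exists>n\<in>N. \<exists>r. u = n + scale r v" if v: "v \<in> Z" "v \<notin> N" and u: "u \<in> Z" for u v
  proof -
    define N' where "N' = {n + scale r v |n r. n \<in> N}"
    have "subspace N'"
      unfolding subspace_def
    proof (intro conjI ballI allI)
      show "0 \<in> N'"
        using subspace_0[OF N(1)] by (auto simp: N'_def intro!: exI[of _ 0])
      fix p assume "p \<in> N'"
      then obtain n r where n: "p = n + scale r v" "n \<in> N"
        by (auto simp: N'_def)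
      show "scale s p \<in> N'" for s
        using subspace_scale[OF N(1) n(2), of s] unfolding N'_def
        by (auto simp: n scale_right_distrib intro!: exI[of _ "scale s n"])
      fix q assume "q \<in> N'"
      then obtain n' r' where n': "q = n' + scale r' v" "n' \<in> N"
        by (auto simp: N'_def)
      have "p + q = (n + n') + scale (r + r') v"
        by (simp add: n n' scale_left_distrib algebra_simps)
      then show "p + q \<in> N'"
        using subspace_add[OF N(1) n(2) n'(2)] unfolding N'_def by blast
    qed
    moreover have "N \<subseteq> N'"
      by (force simp: N'_def intro: exI[of _ 0])
    moreover have "v \<in> N'"
      using subspace_0[OF N(1)] by (force simp: N'_def intro: exI[of _ 0] exI[of _ 1])
    moreover have "N' \<subseteq> Z"
      using N v subspace_add[OF Z] subspace_scale[OF Z] by (auto simp: N'_def)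
    ultimately have "N' = Z"
      using N_max v by blast
    then show ?thesis
      using u by (auto simp: N'_def)
  qed
  interpret maximal_ideal "{r. scale r z \<in> N}"
  proof
    show "0 \<in> {r. scale r z \<in> N}" "1 \<notin> {r. scale r z \<in> N}"
      using z subspace_0[OF N(1)] by auto
    show "a + b \<in> {r. scale r z \<in> N}" if "a \<in> {r. scale r z \<in> N}" "b \<in> {r. scale r z \<in> N}" for a b
      using that subspace_add[OF N(1)] by (simp add: scale_left_distrib)
    show "r * a \<in> {r. scale r z \<in> N}" if "a \<in> {r. scale r z \<in> N}" for a r
      using that subspace_scale[OF N(1), of "scale a z" r] by simp
    \<comment> \<open>Since \<open>scale r z\<close> generates \<open>Z / N\<close>, it has
      \<open>z\<close> as a multiple modulo \<open>N\<close>, and the factor \<open>s\<close>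
      inverts \<open>r\<close>.\<close>
    fix r assume "r \<notin> {r. scale r z \<in> N}"
    then obtain n s where n: "n \<in> N" "z = n + scale s (scale r z)"
      using gen[of "scale r z" z] z subspace_scale[OF Z] by auto
    have "scale (1 - s * r) z = z - scale s (scale r z)"
      by (simp add: scale_left_diff_distrib)
    also have "\<dots> = n"
      by (subst (1) n(2)) simp
    finally show "\<exists>s. 1 - s * r \<in> {r. scale r z \<in> N}"
      using n(1) by auto
  qed
  obtain c where "t - \<phi> c \<in> {r. scale r z \<in> N}"
    using weak_nullstellensatz[OF alg] by blast
  then have c: "scale (t - \<phi> c) z \<in> N"
    by simp
  have "z \<noteq> scale (t - \<phi> c) u + b" if u: "u \<in> Z" and b: "b \<in> B" for u b
  proof -
    obtain n r where n: "n \<in> N" "u = n + scale r z"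
      using gen[OF z u] by blast
    have "scale (t - \<phi> c) u = scale (t - \<phi> c) n + scale r (scale (t - \<phi> c) z)"
      by (simp add: n scale_right_distrib mult.commute)
    then have "scale (t - \<phi> c) u \<in> N"
      using subspace_add[OF N(1) subspace_scale[OF N(1) n(1)] subspace_scale[OF N(1) c]] by metis
    then show ?thesis
      using z b N(2) subspace_add[OF N(1)] by blast
  qed
  then show ?thesis
    using z by blast
qed

text \<open>Submodules of a power of the module under pointwise operations: chains are families,
  whereas \<open>subspace\<close> concerns single coefficients.\<close>

definition family_submodule :: "('r::comm_ring_1 \<Rightarrow> 'm::ab_group_add \<Rightarrow> 'm) \<Rightarrow> ('i \<Rightarrow> 'm) set \<Rightarrow> bool" where
  "family_submodule scale Z \<longleftrightarrow> (\<lambda>_. 0) \<in> Z \<and> (\<forall>c\<in>Z. \<forall>d\<in>Z. (\<lambda>i. c i + d i) \<in> Z) \<and>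
     (\<forall>r. \<forall>c\<in>Z. (\<lambda>i. scale r (c i)) \<in> Z)"

text \<open>Induction on the support. If the images of \<open>B\<close> and \<open>Z\<close> at
  \<open>k\<close> differ, the obstruction is visible in that coordinate; otherwise
  \<open>Z / B\<close> is isomorphic to the subquotient \<open>Z0 / B0\<close> of families vanishing
  at \<open>k\<close>.\<close>

lemma family_subquotient_not_surj:
  fixes \<phi> :: "'k::field \<Rightarrow> 'r::comm_ring_1" and scale :: "'r \<Rightarrow> 'm::ab_group_add \<Rightarrow> 'm"
  assumes alg: "alg_closed TYPE('k)" "is_ring_hom \<phi>" "finitely_generated_algebra \<phi>"
    and noeth: "noetherian_module scale"
    and "finite F" "family_submodule scale Z" "family_submodule scale B" "B \<subset> Z"
    and "\<And>z i. z \<in> Z \<Longrightarrow> i \<notin> F \<Longrightarrow> z i = 0"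
  shows "\<exists>c. \<exists>z\<in>Z. \<forall>u\<in>Z. \<forall>b\<in>B. z \<noteq> (\<lambda>i. scale (t - \<phi> c) (u i) + b i)"
  using assms(5-)
proof (induction F arbitrary: Z B rule: finite_induct)
  case empty
  then have "z = (\<lambda>_. 0)" if "z \<in> Z" for z
    using that by auto
  then show ?case
    using empty by (auto simp: family_submodule_def)
next
  case (insert k F)
  interpret module scale
    using noeth by (simp add: noetherian_module_def)
  note Z = \<open>family_submodule scale Z\<close> and B = \<open>family_submodule scale B\<close>
  have image_sub: "subspace ((\<lambda>c. c k) ` X)" if "family_submodule scale X" for X
  proof -
    have X: "(\<lambda>_. 0) \<in> X" "\<And>c d. c \<in> X \<Longrightarrow> d \<in> X \<Longrightarrow> (\<lambda>i. c i + d i) \<in> X"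
      "\<And>r c. c \<in> X \<Longrightarrow> (\<lambda>i. scale r (c i)) \<in> X"
      using that by (auto simp: family_submodule_def)
    show ?thesis
      unfolding subspace_def using imageI[OF X(1), where f = "\<lambda>c. c k"]
        imageI[OF X(2), where f = "\<lambda>c. c k"] imageI[OF X(3), where f = "\<lambda>c. c k"] by auto
  qed
  show ?case
  proof (cases "(\<lambda>c. c k) ` B = (\<lambda>c. c k) ` Z")
    case False
    then have "(\<lambda>c. c k) ` B \<subset> (\<lambda>c. c k) ` Z"
      using insert.prems(3) by blast
    from noetherian_subquotient_not_surj[OF alg noeth image_sub[OF Z] image_sub[OF B] this, of t]
    obtain c z where "z \<in> (\<lambda>c. c k) ` Z"
      and ne: "\<forall>u\<in>(\<lambda>c. c k) ` Z. \<forall>b\<in>(\<lambda>c. c k) ` B. z \<noteq> scale (t - \<phi> c) u + b"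
      by (elim exE bexE)
    then obtain z' where z': "z' \<in> Z" "z = z' k"
      by blast
    show ?thesis
    proof (intro exI bexI[OF _ z'(1)] ballI notI)
      fix u b assume "u \<in> Z" "b \<in> B" and eq: "z' = (\<lambda>i. scale (t - \<phi> c) (u i) + b i)"
      then show False
        using ne z'(2) fun_cong[OF eq, of k] by blast
    qed
  next
    case True
    define Z0 B0 where "Z0 = {c\<in>Z. c k = 0}" and "B0 = {c\<in>B. c k = 0}"
    have Z_add: "(\<lambda>i. c i + d i) \<in> Z" if "c \<in> Z" "d \<in> Z" for c d
      using Z that unfolding family_submodule_def by blast
    have Z_scale: "(\<lambda>i. scale r (c i)) \<in> Z" if "c \<in> Z" for c r
      using Z that unfolding family_submodule_def by blast
    have Z_minus: "(\<lambda>i. c i - d i) \<in> Z" if "c \<in> Z" "d \<in> Z" for c d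
      using Z_add[OF that(1) Z_scale[OF that(2), of "- 1"]] by simp
    have split: "\<exists>b\<in>B. \<exists>z0\<in>Z0. z = (\<lambda>i. b i + z0 i)" if z: "z \<in> Z" for z
    proof -
      obtain b where b: "b \<in> B" "z k = b k"
        using True z by (metis (no_types, lifting) imageE imageI)
      then have "(\<lambda>i. z i - b i) \<in> Z0"
        using Z_minus[OF z, of b] insert.prems(3) by (auto simp: Z0_def)
      then show ?thesis
        using b by (intro bexI[of _ b] bexI[of _ "\<lambda>i. z i - b i"]) auto
    qed
    have B_add: "(\<lambda>i. b i + d i) \<in> B" if "b \<in> B" "d \<in> B" for b d
      using B that unfolding family_submodule_def by blast
    have B_scale: "(\<lambda>i. scale r (b i)) \<in> B" if "b \<in> B" for b r
      using B that unfolding family_submodule_def by blast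
    have "B0 \<noteq> Z0"
    proof
      assume "B0 = Z0"
      have "z \<in> B" if z: "z \<in> Z" for z
      proof -
        obtain b z0 where "b \<in> B" "z0 \<in> Z0" "z = (\<lambda>i. b i + z0 i)"
          using split[OF z] by (elim bexE)
        then show ?thesis
          using B_add[of b z0] \<open>B0 = Z0\<close> by (auto simp: B0_def)
      qed
      then show False
        using insert.prems(3) by blast
    qed
    then have "B0 \<subset> Z0"
      using insert.prems(3) by (auto simp: Z0_def B0_def)
    moreover have "family_submodule scale Z0" "family_submodule scale B0"
      using Z B by (auto simp: family_submodule_def Z0_def B0_def)
    moreover have "z i = 0" if "z \<in> Z0" "i \<notin> F" for z i
      using that insert.prems(4)[of z i] by (cases "i = k") (auto simp: Z0_def)
    ultimately obtain c z where z: "z \<in> Z0"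
      and ne: "\<And>u b. u \<in> Z0 \<Longrightarrow> b \<in> B0 \<Longrightarrow> z \<noteq> (\<lambda>i. scale (t - \<phi> c) (u i) + b i)"
      using insert.IH[of Z0 B0] by metis
    have "z \<noteq> (\<lambda>i. scale (t - \<phi> c) (u i) + b i)" if u: "u \<in> Z" and b: "b \<in> B" for u b
    proof
      assume eq: "z = (\<lambda>i. scale (t - \<phi> c) (u i) + b i)"
      obtain b' u0 where u0: "b' \<in> B" "u0 \<in> Z0" "u = (\<lambda>i. b' i + u0 i)"
        using split[OF u] by (elim bexE)
      \<comment> \<open>The image of the \<open>B\<close>-part of \<open>u\<close> is absorbed into
        \<open>b\<close>; evaluation at \<open>k\<close> then shows that \<open>d\<close> lies in
        \<open>B0\<close>.\<close>
      define d where "d i = scale (t - \<phi> c) (b' i) + b i" for i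
      have "d \<in> B"
        unfolding d_def by (intro B_add B_scale u0 b)
      moreover have z_eq: "z = (\<lambda>i. scale (t - \<phi> c) (u0 i) + d i)"
        unfolding eq by (simp add: u0(3) d_def scale_right_distrib algebra_simps)
      moreover have "d k = 0"
        using fun_cong[OF z_eq, of k] z u0(2) by (simp add: Z0_def)
      ultimately show False
        using ne[OF u0(2), of d] by (simp add: B0_def)
    qed
    then show ?thesis
      using z by (auto simp: Z0_def)
  qed
qed

section \<open>The projection property\<close>

text \<open>Some homology module of \<open>Kos(y)\<close> is nonzero. For a suitable
  \<open>c\<close>, \<open>t - \<phi> c\<close> is not surjective on it, while exactness of the cone
  would make it surjective.\<close>

lemma not_koszul_exact_snoc:
  fixes \<phi> :: "'k::field \<Rightarrow> 'r::comm_ring_1" and scale :: "'r \<Rightarrow> 'm::ab_group_add \<Rightarrow> 'm"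
  assumes alg: "alg_closed TYPE('k)" "is_ring_hom \<phi>" "finitely_generated_algebra \<phi>"
    and noeth: "noetherian_module scale" and nex: "\<not> koszul_exact scale y"
  shows "\<exists>c. \<not> koszul_exact scale (y @ [t - \<phi> c])"
proof -
  interpret module scale
    using noeth by (simp add: noetherian_module_def)
  let ?Z = "\<lambda>p. {c \<in> koszul_chains (length y) p. koszul_diff scale y c = (\<lambda>_. 0)}"
  let ?B = "\<lambda>p. koszul_diff scale y ` koszul_chains (length y) (Suc p)"
  have chains_sub: "family_submodule scale (koszul_chains n p :: (nat set \<Rightarrow> 'm) set)" for n p
  proof -
    have "c I \<noteq> 0 \<or> d I \<noteq> 0" if "c I + d I \<noteq> 0" for c d :: "nat set \<Rightarrow> 'm" and I
      using that by auto
    moreover have "c I \<noteq> 0" if "scale r (c I) \<noteq> 0" for r I and c :: "nat set \<Rightarrow> 'm"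
      using that by auto
    ultimately show ?thesis
      unfolding family_submodule_def koszul_chains_def by blast
  qed
  have Z: "family_submodule scale (?Z p)" for p
    using chains_sub[of "length y" p]
    by (auto simp: family_submodule_def koszul_diff_0 koszul_diff_add koszul_diff_scale)
  have B: "family_submodule scale (?B p)" for p
    using chains_sub[of "length y" "Suc p"]
    unfolding family_submodule_def
    by (auto simp: image_iff koszul_diff_0 simp flip: koszul_diff_add koszul_diff_scale
        intro: bexI[of _ "\<lambda>_. 0"])
  obtain p where "?B p \<noteq> ?Z p"
    using nex unfolding koszul_exact_def by blast
  then have "?B p \<subset> ?Z p"
    using boundaries_subset_cycles by blast
  moreover have "z I = 0" if "z \<in> ?Z p" "I \<notin> Pow {..<length y}" for z I
    using that by (auto simp: koszul_chains_def)
  ultimately obtain c z where z: "z \<in> ?Z p"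
    and ne: "\<forall>u\<in>?Z p. \<forall>b\<in>?B p. z \<noteq> (\<lambda>I. scale (t - \<phi> c) (u I) + b I)"
    using family_subquotient_not_surj[OF alg noeth _ Z B, of "Pow {..<length y}" p p t] by auto
  have "\<not> koszul_exact scale (y @ [t - \<phi> c])"
    using koszul_exact_snoc_surj[of y "t - \<phi> c" z p] z ne by blast
  then show ?thesis
    by blast
qed

theorem theorem2p11:
  fixes \<phi> :: "'k::field \<Rightarrow> 'r::comm_ring_1"
    and scale :: "'r \<Rightarrow> 'm::ab_group_add \<Rightarrow> 'm"
    and y :: "'r list"
  assumes "alg_closed TYPE('k)"
    and "is_ring_hom \<phi>"
    and "finitely_generated_algebra \<phi>"
    and "noetherian_module scale"
    and "y \<noteq> []"
  shows "taylor_spectrum \<phi> scale (butlast y) = butlast ` taylor_spectrum \<phi> scale y"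
proof -
  interpret module scale
    using assms(4) by (simp add: noetherian_module_def)
  define t where "t = last y"
  define x where "x = butlast y"
  have y: "y = x @ [t]"
    using assms(5) by (simp add: x_def t_def)
  let ?s = "map2 (\<lambda>yi ai. yi - \<phi> ai)"
  have shift_snoc: "?s (x @ [t]) (a @ [c]) = ?s x a @ [t - \<phi> c]" if "length a = length x" for a c
    using that by simp
  show ?thesis
  proof (intro subset_antisym subsetI)
    fix a assume "a \<in> taylor_spectrum \<phi> scale (butlast y)"
    then have a: "length a = length x" "\<not> koszul_exact scale (?s x a)"
      by (auto simp: taylor_spectrum_def x_def)
    obtain c where "\<not> koszul_exact scale (?s x a @ [t - \<phi> c])"
      using not_koszul_exact_snoc[OF assms(1-4) a(2)] by blast
    then have "a @ [c] \<in> taylor_spectrum \<phi> scale y"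
      using a(1) shift_snoc[OF a(1)] by (simp add: taylor_spectrum_def y)
    then show "a \<in> butlast ` taylor_spectrum \<phi> scale y"
      by force
  next
    fix a assume "a \<in> butlast ` taylor_spectrum \<phi> scale y"
    then obtain a' where a': "length a' = Suc (length x)" "\<not> koszul_exact scale (?s y a')"
      "a = butlast a'"
      by (auto simp: taylor_spectrum_def y)
    then have "a' = a @ [last a']"
      by (metis append_butlast_last_id list.size(3) nat.distinct(1))
    moreover have "length a = length x"
      using a' by simp
    ultimately have "\<not> koszul_exact scale (?s x a @ [t - \<phi> (last a')])"
      using a'(2) shift_snoc unfolding y by metis
    \<comment> \<open>If the complex for \<open>a\<close> were exact, it would remain exact for
      every choice of the last coordinate.\<close>
    then have "\<not> koszul_exact scale (?s x a)"
      using koszul_exact_snoc by blast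
    then show "a \<in> taylor_spectrum \<phi> scale (butlast y)"
      using \<open>length a = length x\<close> by (simp add: taylor_spectrum_def x_def)
  qed
qed

end
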